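(* Let $\ell$ and $n$ be nonnegative integers and let $a$ be a complex number such that no zero factor appears in any denominator occurring in the identity below. Then $${}_3F_2\!\left[\begin{matrix}-n,\ a,\ 3a+n-\ell\\ \frac{3a}{2},\ \frac{1+3a}{2}\end{matrix}\,\Big|\,\frac34\right]=\frac{(1-n-3a)_\ell}{(1-2n-3a)_\ell}\sum_{i=0}^{\ell}(-1)^i\,\frac{3a+2n-2i}{3a+2n}\,\frac{(-\ell)_i(-n)_i(-2n-3a)_i}{(1)_i(1-n-3a)_i(1+\ell-2n-3a)_i}\cdot\frac{(\frac13)_{\frac{n-i}{3}}(\frac23)_{\frac{n-i}{3}}}{(\frac13+a)_{\frac{n-i}{3}}(\frac23+a)_{\frac{n-i}{3}}}\,\chi(n-i).$$
   Context: For complex $x$ and an integer $m$, the shifted factorial is $(x)_m=\prod_{k=0}^{m-1}(x+k)$ for $m>0$, $(x)_0=1$, and $(x)_m=(-1)^m/\prod_{k=1}^{-m}(k-x)$ for $m<0$. The hypergeometric series is ${}_3F_2\!\left[\begin{matrix}a_0,a_1,a_2\\ b_1,b_2\end{matrix}\,\Big|\,z\right]=\sum_{k=0}^\infty\frac{(a_0)_k(a_1)_k(a_2)_k}{k!\,(b_1)_k(b_2)_k}z^k$, with parameters such that no zero factors appear in the denominators of the summand; with $a_0=-n$ it is a finite sum over $0\le k\le n$. For an integer $N$, $\chi(N)=1$ if $3\mid N$ and $\chi(N)=0$ otherwise; a summand containing $\chi(n-i)=0$ is understood to be $0$, so only indices $i$ with $(n-i)/3\in\mathbb Z$ contribute.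 *)

theory Defs
  imports Complex_Main
begin

(* In HOL the value is 0 when a negative index puts a zero factor k - x below the line;
   hence shifted_factorial x m \<noteq> 0 always says both that (x)_m is defined and that it
   may be divided by. *)
definition shifted_factorial :: "complex \<Rightarrow> int \<Rightarrow> complex" where
  "shifted_factorial x m =
     (if m \<ge> 0 then pochhammer x (nat m)
      else (- 1) powi m / (\<Prod>k=1..nat (- m). of_nat k - x))"

(* If a numerator parameter is -n, the summands with k > n vanish (0 / 0 = 0 included),
   so the series is the finite sum over k \<le> n. *)
definition hypergeometric_3F2 ::
    "complex \<Rightarrow> complex \<Rightarrow> complex \<Rightarrow> complex \<Rightarrow> complex \<Rightarrow> complex \<Rightarrow> complex" where
  "hypergeometric_3F2 a0 a1 a2 b1 b2 z =
     (\<Sum>k. pochhammer a0 k * pochhammer a1 k * pochhammer a2 k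
             / (fact k * pochhammer b1 k * pochhammer b2 k) * z ^ k)"

definition chi :: "int \<Rightarrow> complex" where
  "chi N = (if 3 dvd N then 1 else 0)"

end

theory Submission
  imports Defs "HOL-Computational_Algebra.Polynomial" "HOL-Computational_Algebra.Formal_Power_Series"
begin

text \<open>
  Write \<open>T(l, n)\<close> for the series, with \<open>a\<close> fixed. For \<open>l = 0\<close>, up to the factor
  \<open>n! / (3a)\<^sub>n\<close>, it is the coefficient of \<open>x\<^sup>n\<close> in
  \<open>(1 - x) powr (- 3a) * (1 + 3x / (1 - x)\<^sup>2) powr (- a) = (1 - x\<^sup>3) powr (- a)\<close>; as the
  coefficients are polynomials in \<open>a\<close>, negative integers \<open>a\<close> suffice, where the identity is the
  \<open>m\<close>-th power of \<open>(1 - x) * ((1 - x)\<^sup>2 + 3x) = 1 - x\<^sup>3\<close>.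
  The contiguous relation
  \<open>(3a + 2n - 1 - l) T(l + 1, n) = (3a + n - 1 - l) T(l, n) + n T(l, n - 1)\<close>
  then expresses \<open>T(l, n)\<close> through the \<open>T(0, n - i)\<close> by induction on \<open>l\<close>.
  The coefficients of this expansion may have poles at indices \<open>i\<close> with \<open>T(0, n - i) = 0\<close>, so it is
  established for non-integral \<open>3a\<close> and the remaining \<open>a\<close> are reached by continuity.
\<close>

unbundle fps_syntax

section \<open>Triplication formula and polynomial functions\<close>

lemma pochhammer_triple:
  fixes z :: "'a::field_char_0"
  shows "pochhammer (3 * z) (3 * n) =
    27 ^ n * pochhammer z n * pochhammer (1 / 3 + z) n * pochhammer (2 / 3 + z) n"
proof (induction n)
  case (Suc n)
  have "pochhammer (3 * z) (3 * Suc n) =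
      pochhammer (3 * z) (3 * n) * ((3 * z + of_nat (3 * n)) * (3 * z + of_nat (3 * n + 1)) * (3 * z + of_nat (3 * n + 2)))"
  proof -
    have "3 * Suc n = Suc (Suc (Suc (3 * n)))" by simp
    then show ?thesis
      unfolding pochhammer_Suc by (simp only: pochhammer_Suc mult.assoc) (simp add: mult_ac)
  qed
  also have "\<dots> = pochhammer (3 * z) (3 * n) * (27 * (z + of_nat n) * (1 / 3 + z + of_nat n) * (2 / 3 + z + of_nat n))"
    by (simp add: algebra_simps)
  finally show ?case
    unfolding Suc.IH pochhammer_Suc power_Suc by (simp only: mult_ac)
qed simp

text \<open>Polynomiality is a property of functions here, so that it can be derived along the
  syntax of an expression without writing a polynomial down.\<close>

definition polyfun :: "('a::comm_semiring_0 \<Rightarrow> 'a) \<Rightarrow> bool" where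
  "polyfun f \<longleftrightarrow> (\<exists>p. \<forall>x. f x = poly p x)"

lemma polyfun_const: "polyfun (\<lambda>x. c)"
  unfolding polyfun_def by (rule exI[of _ "[:c:]"]) simp

lemma polyfun_id: "polyfun (\<lambda>x::'a::comm_semiring_1. x)"
  unfolding polyfun_def by (rule exI[of _ "[:0, 1:]"]) simp

lemma polyfun_add: "polyfun f \<Longrightarrow> polyfun g \<Longrightarrow> polyfun (\<lambda>x. f x + g x)"
  unfolding polyfun_def by (metis poly_add)

lemma polyfun_mult: "polyfun f \<Longrightarrow> polyfun g \<Longrightarrow> polyfun (\<lambda>x. f x * g x)"
  for f :: "'a::comm_semiring_0 \<Rightarrow> 'a"
  unfolding polyfun_def by (metis poly_mult)

lemma polyfun_divide: "polyfun f \<Longrightarrow> polyfun (\<lambda>x. f x / c)"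
  for f :: "'a::field \<Rightarrow> 'a"
  using polyfun_mult[OF _ polyfun_const[of "inverse c"]] by (simp add: divide_inverse)

lemma polyfun_sum: "(\<And>i. i \<in> I \<Longrightarrow> polyfun (f i)) \<Longrightarrow> polyfun (\<lambda>x. \<Sum>i\<in>I. f i x)"
  by (induction I rule: infinite_finite_induct) (auto intro: polyfun_const polyfun_add)

lemma polyfun_pochhammer:
  "polyfun f \<Longrightarrow> polyfun (\<lambda>x. pochhammer (f x) n)" for f :: "'a::comm_semiring_1 \<Rightarrow> 'a"
  by (induction n) (auto simp: pochhammer_Suc intro!: polyfun_const polyfun_add polyfun_mult)

lemmas polyfun_intros = polyfun_const polyfun_id polyfun_add polyfun_mult polyfun_divide
  polyfun_sum polyfun_pochhammer

lemma polyfun_eqI: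
  fixes f g :: "'a::idom \<Rightarrow> 'a"
  assumes "polyfun f" "polyfun g" "infinite {x. f x = g x}"
  shows "f x = g x"
proof -
  obtain p q where p: "\<And>x. f x = poly p x" and q: "\<And>x. g x = poly q x"
    using assms unfolding polyfun_def by metis
  have "infinite {x. poly (p - q) x = 0}"
    using assms(3) by (simp add: p q)
  then have "p - q = 0"
    using poly_roots_finite by blast
  then show ?thesis by (simp add: p q)
qed

section \<open>The case l = 0: a cubic generating function\<close>

text \<open>Binomial theorem with (-1)^k (m choose k) = (-m)_k / k!. In this form \<open>m\<close>
  enters only through -m, the value later taken by \<open>a\<close>. It is applied with r = 1 and r
  = 3.\<close>

lemma fps_one_minus_X_power_power_nth:
  fixes r m n :: nat
  assumes r: "r > 0"
  shows "(1 - fps_X ^ r :: 'a::field_char_0 fps) ^ m $ n =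
    (if r dvd n then pochhammer (- of_nat m) (n div r) / fact (n div r) else 0)"
proof -
  let ?X = "fps_X :: 'a fps" and ?a = "- of_nat m :: 'a"
  have "(1 - ?X ^ r) ^ m = (\<Sum>k\<le>m. of_nat (m choose k) * (- (?X ^ r)) ^ k * 1 ^ (m - k))"
    using binomial_ring[of "- (?X ^ r)" 1 m] by simp
  also have "\<dots> = (\<Sum>k\<le>m. fps_const (pochhammer ?a k / fact k) * ?X ^ (r * k))"
  proof (rule sum.cong[OF refl])
    fix k
    have "fps_const (pochhammer ?a k / fact k) = fps_const (of_nat (m choose k) * (-1) ^ k)"
      unfolding binomial_gbinomial gbinomial_pochhammer
      by (simp add: mult_ac flip: mult.assoc[of "(- 1) ^ k" "(- 1) ^ k"] power_mult_distrib)
    also have "\<dots> = (of_nat (m choose k) * (-1) ^ k :: 'a fps)"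
      by (simp add: fps_of_nat numeral_fps_const flip: fps_const_mult fps_const_power fps_const_neg)
    finally show "of_nat (m choose k) * (- (?X ^ r)) ^ k * 1 ^ (m - k) =
        fps_const (pochhammer ?a k / fact k) * ?X ^ (r * k)"
      by (simp add: power_mult power_minus[of "?X ^ r"])
  qed
  finally have "(1 - ?X ^ r) ^ m $ n =
      (\<Sum>k\<le>m. (pochhammer ?a k / fact k) * (if n = r * k then 1 else 0))"
    by (simp add: fps_sum_nth)
  also have "\<dots> = (\<Sum>k\<in>{k. k \<le> m \<and> n = r * k}. pochhammer ?a k / fact k)"
    by (rule sum.mono_neutral_cong_right) auto
  also have "\<dots> = (if r dvd n then pochhammer ?a (n div r) / fact (n div r) else 0)"
  proof (cases "r dvd n \<and> n div r \<le> m")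
    case True
    then have "{k. k \<le> m \<and> n = r * k} = {n div r}" using r by auto
    with True show ?thesis by simp
  next
    \<comment> \<open>If r divides n but n div r > m, the closed form vanishes as well, since (-m)_j
      = 0 for j > m.\<close>
    case False
    then have empty: "{k. k \<le> m \<and> n = r * k} = {}" using r by auto
    show ?thesis
      unfolding empty using False by (auto simp: pochhammer_of_nat_eq_0_iff)
  qed
  finally show ?thesis .
qed

lemma cubic_generating_sum_neg_nat:
  fixes m n :: nat
  defines "a \<equiv> - of_nat m :: 'a::field_char_0"
  shows "(\<Sum>k\<le>n. (- 3) ^ k * pochhammer a k / fact k *
            (pochhammer (3 * a + 2 * of_nat k) (n - k) / fact (n - k))) =
         (if 3 dvd n then pochhammer a (n div 3) / fact (n div 3) else 0)"
proof -
  let ?X = "fps_X :: 'a fps"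
  have "(1 - ?X ^ 3) ^ m = ((1 - ?X) * (3 * ?X + (1 - ?X)\<^sup>2)) ^ m"
    by (rule arg_cong[of _ _ "\<lambda>f. f ^ m"]) (simp add: algebra_simps power2_eq_square power3_eq_cube)
  also have "\<dots> = (\<Sum>k\<le>m. (1 - ?X) ^ m * (of_nat (m choose k) * (3 * ?X) ^ k * ((1 - ?X)\<^sup>2) ^ (m - k)))"
    by (simp only: power_mult_distrib[of "1 - ?X"] binomial_ring sum_distrib_left)
  also have "\<dots> = (\<Sum>k\<le>m. fps_const (of_nat (m choose k) * 3 ^ k) * (?X ^ k * (1 - ?X) ^ (3 * m - 2 * k)))"
  proof (rule sum.cong[OF refl])
    fix k assume "k \<in> {..m}"
    \<comment> \<open>The outer factor contributes m and the square 2(m - k); k \<le> m makes the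
      natural subtraction exact.\<close>
    then have e: "3 * m - 2 * k = m + 2 * (m - k)" by simp
    have "fps_const (of_nat (m choose k) * 3 ^ k) = (of_nat (m choose k) * 3 ^ k :: 'a fps)"
      by (simp add: fps_of_nat numeral_fps_const flip: fps_const_mult fps_const_power)
    then show "(1 - ?X) ^ m * (of_nat (m choose k) * (3 * ?X) ^ k * ((1 - ?X)\<^sup>2) ^ (m - k)) =
        fps_const (of_nat (m choose k) * 3 ^ k) * (?X ^ k * (1 - ?X) ^ (3 * m - 2 * k))"
      unfolding e power_add power_mult power_mult_distrib by (simp only: mult_ac)
  qed
  finally have "(1 - ?X ^ 3) ^ m $ n =
      (\<Sum>k\<le>m. of_nat (m choose k) * 3 ^ k * (?X ^ k * (1 - ?X) ^ (3 * m - 2 * k)) $ n)"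
    by (simp add: fps_sum_nth)
  also have "\<dots> = (\<Sum>k\<le>m. (if k \<le> n then (- 3) ^ k * pochhammer a k / fact k *
            (pochhammer (3 * a + 2 * of_nat k) (n - k) / fact (n - k)) else 0))"
  proof (rule sum.cong[OF refl])
    fix k assume k: "k \<in> {..m}"
    have "of_nat (m choose k) * 3 ^ k = (- 3) ^ k * pochhammer a k / (fact k :: 'a)"
      unfolding a_def binomial_gbinomial gbinomial_pochhammer
      by (simp add: power_minus[of 3])
    moreover have "(?X ^ k * (1 - ?X) ^ (3 * m - 2 * k)) $ n =
      (if k \<le> n then pochhammer (3 * a + 2 * of_nat k) (n - k) / fact (n - k) else 0)"
      \<comment> \<open>The case r = 1 with exponent 3m - 2k, whose negative is 3a + 2k.\<close>
      using k by (simp add: fps_X_power_mult_nth fps_one_minus_X_power_power_nth[of 1, simplified] a_def of_nat_diff algebra_simps)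
    ultimately show "of_nat (m choose k) * 3 ^ k * (?X ^ k * (1 - ?X) ^ (3 * m - 2 * k)) $ n =
      (if k \<le> n then (- 3) ^ k * pochhammer a k / fact k *
            (pochhammer (3 * a + 2 * of_nat k) (n - k) / fact (n - k)) else 0)"
      by simp
  qed
  also have "\<dots> = (\<Sum>k\<le>n. (- 3) ^ k * pochhammer a k / fact k *
            (pochhammer (3 * a + 2 * of_nat k) (n - k) / fact (n - k)))"
    \<comment> \<open>The ranges k \<le> m and k \<le> n may differ: terms with k > m vanish through
      (-m)_k, those with k > n through the \<open>if\<close>.\<close>
    by (rule sum.mono_neutral_cong) (auto simp: a_def pochhammer_of_nat_eq_0_iff)
  finally have "(1 - ?X ^ 3) ^ m $ n = (\<Sum>k\<le>n. (- 3) ^ k * pochhammer a k / fact k *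
            (pochhammer (3 * a + 2 * of_nat k) (n - k) / fact (n - k)))" .
  then show ?thesis
    unfolding fps_one_minus_X_power_power_nth[OF zero_less_numeral] a_def by (rule sym)
qed

lemma cubic_generating_sum:
  fixes a :: "'a::field_char_0"
  shows "(\<Sum>k\<le>n. (- 3) ^ k * pochhammer a k / fact k *
            (pochhammer (3 * a + 2 * of_nat k) (n - k) / fact (n - k))) =
         (if 3 dvd n then pochhammer a (n div 3) / fact (n div 3) else 0)"
    (is "?f a = ?g a")
proof (rule polyfun_eqI[of ?f ?g])
  show "polyfun ?f" by (intro polyfun_intros)
  \<comment> \<open>The condition 3 dvd n does not involve \<open>a\<close>, so each branch is a
    polynomial in \<open>a\<close>.\<close>
  show "polyfun ?g" by (cases "3 dvd n") (auto intro!: polyfun_intros)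
  have "range (\<lambda>m. - of_nat m) \<subseteq> {x. ?f x = ?g x}"
    using cubic_generating_sum_neg_nat[where 'a = 'a] by blast
  moreover have "infinite (range (\<lambda>m. - of_nat m :: 'a))"
    by (rule range_inj_infinite) (simp add: inj_def)
  ultimately show "infinite {x. ?f x = ?g x}"
    by (rule infinite_super)
qed

text \<open>The series after merging its lower parameters by duplication: (3a)_{2k} absorbs the 4^k
  of (3/4)^k. The bracketed weight depends on \<open>a\<close> and \<open>k\<close> only, which the
  contiguous relation exploits.\<close>

definition cubic_sum :: "nat \<Rightarrow> nat \<Rightarrow> 'a::field_char_0 \<Rightarrow> 'a" where
  "cubic_sum l n a = (\<Sum>k\<le>n. pochhammer (- of_nat n) k * pochhammer (3 * a + of_nat n - of_nat l) k *
     (3 ^ k * pochhammer a k / (fact k * pochhammer (3 * a) (2 * k))))"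

lemma pochhammer_nonint_nonzero: "z \<notin> \<int> \<Longrightarrow> pochhammer z k \<noteq> 0" for z :: "'a::field_char_0"
  by (metis Ints_minus Ints_of_nat pochhammer_eq_0_iff)

lemma nonint_add_of_nat: "z \<notin> \<int> \<Longrightarrow> z + of_nat n \<notin> \<int>" for z :: "'a::ring_1"
  by (metis Ints_diff Ints_of_nat add_diff_cancel_right')

lemma cubic_sum_0:
  fixes a :: "'a::field_char_0"
  assumes "3 * a \<notin> \<int>"
  shows "cubic_sum 0 n a =
    (if 3 dvd n then pochhammer (1 / 3) (n div 3) * pochhammer (2 / 3) (n div 3) /
       (pochhammer (1 / 3 + a) (n div 3) * pochhammer (2 / 3 + a) (n div 3)) else 0)"
proof -
  note nz = pochhammer_nonint_nonzero[OF assms]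
  have "cubic_sum 0 n a = fact n / pochhammer (3 * a) n * (\<Sum>k\<le>n. (- 3) ^ k * pochhammer a k / fact k *
            (pochhammer (3 * a + 2 * of_nat k) (n - k) / fact (n - k)))"
    unfolding cubic_sum_def sum_distrib_left
  proof (rule sum.cong[OF refl])
    fix k assume "k \<in> {..n}"
    then have k: "k \<le> n" by simp
    have 1: "pochhammer (- of_nat n) k = (- 1) ^ k * fact n / (fact (n - k) :: 'a)"
    proof -
      have "(of_nat (n choose k) :: 'a) = (- 1) ^ k * pochhammer (- of_nat n) k / fact k"
        by (simp add: binomial_gbinomial gbinomial_pochhammer)
      moreover have "of_nat (n choose k) = (fact n / (fact k * fact (n - k)) :: 'a)"
        using k by (rule binomial_fact)
      ultimately have "(- 1) ^ k * pochhammer (- of_nat n) k = (fact n / fact (n - k) :: 'a)"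
        by (simp add: field_simps)
      then have "(- 1) ^ k * ((- 1) ^ k * pochhammer (- of_nat n) k) = ((- 1) ^ k * (fact n / fact (n - k)) :: 'a)"
        by simp
      then show ?thesis
        by (simp flip: mult.assoc power_add power_mult_distrib)
    qed
    \<comment> \<open>Splitting (3a)_{n+k} at n and at 2k brings out the factor (3a)_{2k} that
      cancels the denominator of the weight.\<close>
    have "pochhammer (3 * a) n * pochhammer (3 * a + of_nat n) k = pochhammer (3 * a) (n + k)"
      by (simp add: pochhammer_product')
    also have "\<dots> = pochhammer (3 * a) (2 * k) * pochhammer (3 * a + 2 * of_nat k) (n - k)"
      using k pochhammer_product'[of "3 * a" "2 * k" "n - k"] by (simp add: add.commute)
    finally have "pochhammer (3 * a) n * pochhammer (3 * a + of_nat n) k =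
        pochhammer (3 * a) (2 * k) * pochhammer (3 * a + 2 * of_nat k) (n - k)" .
    then have 2: "pochhammer (3 * a + of_nat n) k =
        pochhammer (3 * a) (2 * k) * pochhammer (3 * a + 2 * of_nat k) (n - k) / pochhammer (3 * a) n"
      using nz by (simp add: nonzero_eq_divide_eq mult.commute)
    have 3: "(- 3) ^ k = (- 1) ^ k * (3 ^ k :: 'a)"
      by (simp flip: power_mult_distrib)
    show "pochhammer (- of_nat n) k * pochhammer (3 * a + of_nat n - of_nat 0) k *
        (3 ^ k * pochhammer a k / (fact k * pochhammer (3 * a) (2 * k))) =
        fact n / pochhammer (3 * a) n * ((- 3) ^ k * pochhammer a k / fact k *
            (pochhammer (3 * a + 2 * of_nat k) (n - k) / fact (n - k)))"
      using nz by (simp add: 1 2 3) (simp only: mult_ac)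
  qed
  also have "\<dots> = (if 3 dvd n then fact n / pochhammer (3 * a) n * (pochhammer a (n div 3) / fact (n div 3)) else 0)"
    unfolding cubic_generating_sum by simp
  also have "\<dots> = (if 3 dvd n then pochhammer (1 / 3) (n div 3) * pochhammer (2 / 3) (n div 3) /
       (pochhammer (1 / 3 + a) (n div 3) * pochhammer (2 / 3 + a) (n div 3)) else 0)"
  proof (cases "3 dvd n")
    case True
    then obtain m where m: "n = 3 * m" ..
    \<comment> \<open>Triplication at 1/3 splits (3m)! = (1)_{3m}, and at \<open>a\<close> it splits
      (3a)_{3m}; then (a)_m and m! cancel.\<close>
    have f: "(fact (3 * m) :: 'a) = 27 ^ m * pochhammer (1 / 3) m * pochhammer (2 / 3) m * fact m"
      using pochhammer_triple[of "1/3::'a" m] by (simp add: pochhammer_fact mult_ac)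
    have "pochhammer a m \<noteq> 0"
      using nz[of "3 * m"] pochhammer_triple[of a m] by auto
    then show ?thesis
      by (simp add: m f pochhammer_triple)
  qed simp
  finally show ?thesis .
qed

section \<open>Contiguous relation in l\<close>

text \<open>The two shifted products on the right are (-N)_k (d)_k times d + k and N - k
  respectively, and these multipliers add up to N + d.\<close>

lemma pochhammer_contiguous:
  fixes N d :: "'a::field_char_0"
  shows "(N + d) * (pochhammer (- N) k * pochhammer d k) =
    d * (pochhammer (- N) k * pochhammer (d + 1) k) + N * (pochhammer (- (N - 1)) k * pochhammer d k)"
proof -
  have "d * pochhammer (d + 1) k = pochhammer d k * (d + of_nat k)"
    by (metis pochhammer_Suc pochhammer_rec)
  moreover have "N * pochhammer (- (N - 1)) k = - (pochhammer (- N) k * (- N + of_nat k))"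
    using pochhammer_rec[of "- N" k] by (simp add: pochhammer_Suc algebra_simps)
  ultimately show ?thesis
    by algebra
qed

text \<open>Apply \<open>pochhammer_contiguous\<close> term by term with N = n and d = 3a + n - 1 -
  l; the three sums share the same weights.\<close>

lemma cubic_sum_contiguous:
  fixes a :: "'a::field_char_0"
  shows "(3 * a + 2 * of_nat n - 1 - of_nat l) * cubic_sum (Suc l) n a =
    (3 * a + of_nat n - 1 - of_nat l) * cubic_sum l n a + of_nat n * cubic_sum l (n - 1) a"
proof -
  define N d where "N = (of_nat n :: 'a)" and "d = 3 * a + of_nat n - 1 - of_nat l"
  define w where "w k = 3 ^ k * pochhammer a k / (fact k * pochhammer (3 * a) (2 * k))" for k
  have T1: "cubic_sum (Suc l) n a = (\<Sum>k\<le>n. pochhammer (- N) k * pochhammer d k * w k)"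
    by (simp add: cubic_sum_def w_def N_def d_def algebra_simps)
  have T2: "cubic_sum l n a = (\<Sum>k\<le>n. pochhammer (- N) k * pochhammer (d + 1) k * w k)"
    by (simp add: cubic_sum_def w_def N_def d_def algebra_simps)
  have T3: "of_nat n * cubic_sum l (n - 1) a = N * (\<Sum>k\<le>n. pochhammer (- (N - 1)) k * pochhammer d k * w k)"
  \<comment> \<open>The range can be extended to k = n because (-(n - 1))_n = 0 for n > 0. For n = 0
    the truncated n - 1 is harmless, as both sides carry the factor 0.\<close>
  proof (cases n)
    case (Suc m)
    have [simp]: "- (N - 1) = - of_nat m" "d = 3 * a + of_nat m - of_nat l"
      by (simp_all add: N_def d_def Suc)
    show ?thesis
      by (simp add: Suc cubic_sum_def w_def N_def pochhammer_of_nat_eq_0_iff)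
  qed (simp add: N_def)
  have "(N + d) * (\<Sum>k\<le>n. pochhammer (- N) k * pochhammer d k * w k) =
     d * (\<Sum>k\<le>n. pochhammer (- N) k * pochhammer (d + 1) k * w k) +
     N * (\<Sum>k\<le>n. pochhammer (- (N - 1)) k * pochhammer d k * w k)"
    unfolding sum_distrib_left sum.distrib[symmetric]
    by (intro sum.cong refl) (metis pochhammer_contiguous distrib_right mult.assoc)
  then show ?thesis
    unfolding T1 T2 T3 by (simp add: N_def d_def algebra_simps)
qed

section \<open>Expansion through the case l = 0\<close>

text \<open>The coefficient of T(0, n - i) in T(l, n), with N = n and b = 3a + n. Lowering n by one
  lowers both N and b. With a single Pochhammer symbol in the denominator the recurrence in l is
  easier to check than in the form of \<open>connection_coeff_eq\<close>.\<close>

definition connection_coeff :: "nat \<Rightarrow> 'a \<Rightarrow> 'a \<Rightarrow> nat \<Rightarrow> 'a::field_char_0" where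
  "connection_coeff l N b i = of_nat (l choose i) * pochhammer (- N) i *
     pochhammer (1 - b + of_nat i) (l - i) * (2 * of_nat i - (N + b)) /
     pochhammer (of_nat i - (N + b)) (Suc l)"

lemma connection_coeff_0_0:
  assumes "N + b \<noteq> 0"
  shows "connection_coeff 0 N b 0 = 1"
proof -
  define A where "A = N + b"
  show ?thesis
    using assms unfolding connection_coeff_def A_def[symmetric] by simp
qed

lemma connection_coeff_0:
  assumes "N + b \<notin> \<int>"
  shows "(N + b - 1 - of_nat l) * connection_coeff (Suc l) N b 0 =
     (b - 1 - of_nat l) * connection_coeff l N b 0"
proof -
  have "- (N + b) \<notin> \<int>" using assms Ints_minus[of "- (N + b)"] by (metis minus_minus)
  note nz = pochhammer_nonint_nonzero[OF this]
  have "pochhammer (- (N + b)) (Suc (Suc l)) = pochhammer (- (N + b)) (Suc l) * (1 + of_nat l - (N + b))"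
    "pochhammer (1 - b) (Suc l) = pochhammer (1 - b) l * (1 - b + of_nat l)"
    by (simp_all add: pochhammer_Suc algebra_simps)
  moreover have "1 + of_nat l - (N + b) \<noteq> 0"
    using calculation(1) nz[of "Suc (Suc l)"] by auto
  ultimately show ?thesis
    using nz[of "Suc l"] unfolding connection_coeff_def
    by (simp add: divide_simps del: pochhammer_Suc) (simp add: algebra_simps)
qed

text \<open>All three coefficients are multiples of one quantity \<open>C\<close>. What remains is
  an identity between binomial coefficients, which Pascal's rule reduces to (i + 1) (l choose i + 1)
  = (l - i) (l choose i). For i > l every binomial is zero.\<close>

lemma connection_coeff_Suc:
  fixes N b :: "'a::field_char_0"
  assumes "N + b \<notin> \<int>"
  shows "(N + b - 1 - of_nat l) * connection_coeff (Suc l) N b (Suc i) =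
     (b - 1 - of_nat l) * connection_coeff l N b (Suc i) + N * connection_coeff l (N - 1) (b - 1) i"
proof (cases "i \<le> l")
  case i: True
  define A where "A = N + b"
  define z where "z = of_nat (Suc i) - A"
  define u where "u = (of_nat i :: 'a)"
  define v where "v = (of_nat l :: 'a)"
  have "z \<notin> \<int>"
    using Ints_diff[of "of_nat (Suc i)" z] assms by (auto simp: z_def A_def)
  note nz = pochhammer_nonint_nonzero[OF this]
  have p1: "pochhammer z (Suc (Suc l)) = pochhammer z (Suc l) * (z + v + 1)"
    by (simp add: pochhammer_Suc v_def algebra_simps)
  have p2: "pochhammer z (Suc (Suc l)) = z * pochhammer (z + 1) (Suc l)"
    by (simp add: pochhammer_rec)
  have nz1: "pochhammer z (Suc l) \<noteq> 0" "z + v + 1 \<noteq> 0" "z \<noteq> 0" "pochhammer (z + 1) (Suc l) \<noteq> 0"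
    "pochhammer z (Suc (Suc l)) \<noteq> 0"
    using nz[of "Suc (Suc l)"] p1 p2 by auto
  define P where "P = pochhammer (1 - b + of_nat (Suc i)) (l - i)"
  define C where "C = pochhammer (- N) (Suc i) * P * (2 * of_nat (Suc i) - A) / pochhammer z (Suc (Suc l))"
  have c1: "connection_coeff (Suc l) N b (Suc i) = of_nat (Suc l choose Suc i) * C"
    by (simp only: connection_coeff_def C_def P_def diff_Suc_Suc A_def z_def) simp
  have c2: "(b - 1 - v) * connection_coeff l N b (Suc i) = - of_nat (l choose Suc i) * (z + v + 1) * C"
  \<comment> \<open>For i = l both sides vanish with l choose (l + 1); otherwise l - i is a
    successor and the last factor 1 - b + l can be split off \<open>P\<close>.\<close>
  proof (cases "i = l")
    case False
    with i have "l - i = Suc (l - Suc i)" by simp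
    moreover have "of_nat (l - Suc i) = v - u - 1"
      using i False by (simp add: u_def v_def of_nat_diff)
    ultimately have P: "P = pochhammer (1 - b + of_nat (Suc i)) (l - Suc i) * (1 - b + v)"
      unfolding P_def by (simp add: pochhammer_Suc u_def)
    define W where "W = pochhammer (- N) (Suc i) * pochhammer (1 - b + of_nat (Suc i)) (l - Suc i) *
      (2 * of_nat (Suc i) - A) / pochhammer z (Suc l)"
    have "(z + v + 1) * C = (1 - b + v) * W"
      unfolding C_def P p1 W_def using nz1 by simp
    moreover have "connection_coeff l N b (Suc i) = of_nat (l choose Suc i) * W"
      by (simp add: connection_coeff_def W_def A_def z_def mult.assoc)
    ultimately show ?thesis by algebra
  qed (simp add: connection_coeff_def binomial_eq_0)
  have c3: "N * connection_coeff l (N - 1) (b - 1) i = - of_nat (l choose i) * z * C"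
  proof -
    have q: "N * pochhammer (- (N - 1)) i = - pochhammer (- N) (Suc i)"
      by (simp add: pochhammer_rec algebra_simps)
    \<comment> \<open>Lowering N, b and the index together preserves the second Pochhammer base and
      the linear factor; only the base of the denominator moves, from z to z + 1.\<close>
    have e: "1 - (b - 1) + of_nat i = 1 - b + of_nat (Suc i)"
      "2 * of_nat i - (N - 1 + (b - 1)) = 2 * of_nat (Suc i) - A"
      "of_nat i - (N - 1 + (b - 1)) = z + 1"
      by (simp_all add: A_def z_def)
    have "N * connection_coeff l (N - 1) (b - 1) i = of_nat (l choose i) *
        (N * pochhammer (- (N - 1)) i) * P * (2 * of_nat (Suc i) - A) / pochhammer (z + 1) (Suc l)"
      unfolding connection_coeff_def e P_def by (simp only: times_divide_eq_right mult_ac)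
    also have "\<dots> = - of_nat (l choose i) * pochhammer (- N) (Suc i) * P * (2 * of_nat (Suc i) - A) / pochhammer (z + 1) (Suc l)"
      unfolding q by simp
    also have "\<dots> = - of_nat (l choose i) * z * C"
      unfolding C_def p2 using nz1 by simp
    finally show ?thesis .
  qed
  have "(u + 1) * of_nat (l choose Suc i) = (v - u) * (of_nat (l choose i) :: 'a)"
  proof -
    have "Suc i * (l choose Suc i) = (l - i) * (l choose i)"
      by (metis binomial_absorb_comp binomial_absorption mult.commute)
    then have "of_nat (Suc i) * of_nat (l choose Suc i) = (of_nat (l - i) * of_nat (l choose i) :: 'a)"
      by (metis of_nat_mult)
    then show ?thesis using i by (simp add: u_def v_def of_nat_diff add.commute)
  qed
  then have "(A - 1 - v) * of_nat (Suc l choose Suc i) =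
      - of_nat (l choose Suc i) * (z + v + 1) + - of_nat (l choose i) * z"
    by (simp add: z_def algebra_simps flip: u_def)
  then show ?thesis
    unfolding c1 v_def[symmetric] c2 c3 A_def[symmetric]
    by (metis distrib_right mult.assoc)
qed (simp add: connection_coeff_def binomial_eq_0)

lemma cubic_sum_expansion:
  fixes a :: "'a::field_char_0"
  assumes a: "3 * a \<notin> \<int>"
  shows "cubic_sum l n a =
    (\<Sum>i\<le>l. connection_coeff l (of_nat n) (3 * a + of_nat n) i * cubic_sum 0 (n - i) a)"
proof (induction l arbitrary: n)
  case 0
  have "of_nat n + (3 * a + of_nat n) \<notin> \<int>"
    using nonint_add_of_nat[OF a, of "n + n"] by (simp add: add_ac)
  then have "of_nat n + (3 * a + of_nat n) \<noteq> 0" by (metis Ints_0)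
  then show ?case by (simp add: connection_coeff_0_0)
next
  case (Suc l)
  define N where "N = (of_nat n :: 'a)"
  define b where "b = 3 * a + N"
  have Nb: "N + b \<notin> \<int>"
    using nonint_add_of_nat[OF a, of "n + n"] by (simp add: b_def N_def add_ac)
  have nz: "N + b - 1 - of_nat l \<noteq> 0"
    using Nb Ints_of_nat[of "Suc l"] by (auto simp: algebra_simps)
  have S: "of_nat n * cubic_sum l (n - 1) a =
    N * (\<Sum>i\<le>l. connection_coeff l (N - 1) (b - 1) i * cubic_sum 0 (n - Suc i) a)"
  proof (cases n)
    case (Suc m)
    then show ?thesis
      by (simp add: Suc.IH N_def b_def)
  qed (simp add: N_def)
  let ?c = connection_coeff
  have "(N + b - 1 - of_nat l) * (\<Sum>i\<le>Suc l. ?c (Suc l) N b i * cubic_sum 0 (n - i) a) =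
      (N + b - 1 - of_nat l) * ?c (Suc l) N b 0 * cubic_sum 0 n a +
      (\<Sum>i\<le>l. (N + b - 1 - of_nat l) * ?c (Suc l) N b (Suc i) * cubic_sum 0 (n - Suc i) a)"
    by (simp only: sum.atMost_Suc_shift distrib_left sum_distrib_left mult.assoc) simp
  also have "\<dots> = (b - 1 - of_nat l) * (?c l N b 0 * cubic_sum 0 n a +
       (\<Sum>i\<le>l. ?c l N b (Suc i) * cubic_sum 0 (n - Suc i) a)) +
      N * (\<Sum>i\<le>l. ?c l (N - 1) (b - 1) i * cubic_sum 0 (n - Suc i) a)"
    unfolding connection_coeff_0[OF Nb] connection_coeff_Suc[OF Nb]
    by (simp add: distrib_left distrib_right sum_distrib_left sum.distrib mult.assoc)
  also have "?c l N b 0 * cubic_sum 0 n a + (\<Sum>i\<le>l. ?c l N b (Suc i) * cubic_sum 0 (n - Suc i) a) =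
      (\<Sum>i\<le>Suc l. ?c l N b i * cubic_sum 0 (n - i) a)"
    by (simp only: sum.atMost_Suc_shift) simp
  \<comment> \<open>The extra summand at i = l + 1 vanishes with its binomial, so the induction
    hypothesis applies.\<close>
  also have "\<dots> = cubic_sum l n a"
    by (simp add: Suc.IH N_def b_def connection_coeff_def)
  also have "(b - 1 - of_nat l) * cubic_sum l n a +
      N * (\<Sum>i\<le>l. ?c l (N - 1) (b - 1) i * cubic_sum 0 (n - Suc i) a) =
      (N + b - 1 - of_nat l) * cubic_sum (Suc l) n a"
  proof -
    have "N + b - 1 - of_nat l = 3 * a + 2 * of_nat n - 1 - of_nat l"
      "b - 1 - of_nat l = 3 * a + of_nat n - 1 - of_nat l"
      by (simp_all add: N_def b_def)
    then show ?thesis by (simp only: cubic_sum_contiguous S)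
  qed
  finally show ?case
    using nz by (simp add: N_def b_def)
qed

text \<open>With A = N + b, split (-A)_{i+l+1} after i factors, and alternatively after the first
  factor and l further ones. Together with (1 - b)_l split at i and the binomial as (-1)^i (-l)_i /
  i!, this gives the hypergeometric shape.\<close>

lemma connection_coeff_eq:
  fixes N b :: "'a::field_char_0"
  assumes b: "b \<notin> \<int>" and A: "N + b \<notin> \<int>" and i: "i \<le> l"
  shows "connection_coeff l N b i =
    pochhammer (1 - b) l / pochhammer (1 - (N + b)) l *
    ((- 1) ^ i * ((N + b - 2 * of_nat i) / (N + b)) *
     (pochhammer (- of_nat l) i * pochhammer (- N) i * pochhammer (- (N + b)) i /
      (pochhammer 1 i * pochhammer (1 - b) i * pochhammer (1 + of_nat l - (N + b)) i)))"
proof -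
  define A where "A = N + b"
  have "1 - b \<notin> \<int>" using b Ints_diff[of 1 "1 - b"] by auto
  note nzb = pochhammer_nonint_nonzero[OF this]
  have "- A \<notin> \<int>" using A Ints_minus[of "- A"] unfolding A_def by (metis minus_minus)
  note nzA = pochhammer_nonint_nonzero[OF this]
  have p1: "pochhammer (1 - b) l = pochhammer (1 - b) i * pochhammer (1 - b + of_nat i) (l - i)"
    using i by (rule pochhammer_product)
  have "pochhammer (- A) i * pochhammer (of_nat i - A) (Suc l) = pochhammer (- A) (i + Suc l)"
    by (simp only: pochhammer_product') (simp add: algebra_simps)
  also have "\<dots> = - A * pochhammer (1 - A) (l + i)"
    using pochhammer_rec[of "- A" "l + i"] by (simp add: algebra_simps)
  also have "\<dots> = - A * (pochhammer (1 - A) l * pochhammer (1 + of_nat l - A) i)"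
    by (simp only: pochhammer_product') (simp add: algebra_simps)
  finally have p2: "pochhammer (- A) i * pochhammer (of_nat i - A) (Suc l) =
    - A * (pochhammer (1 - A) l * pochhammer (1 + of_nat l - A) i)" .
  have nz: "pochhammer (- A) i \<noteq> 0" "pochhammer (of_nat i - A) (Suc l) \<noteq> 0" "A \<noteq> 0"
    "pochhammer (1 - A) l \<noteq> 0" "pochhammer (1 + of_nat l - A) i \<noteq> 0"
  proof -
    have "pochhammer (- A) i * pochhammer (of_nat i - A) (Suc l) \<noteq> 0"
      using nzA[of "i + Suc l"] pochhammer_product'[of "- A" i "Suc l"] by (simp add: algebra_simps)
    then show "pochhammer (- A) i \<noteq> 0" "pochhammer (of_nat i - A) (Suc l) \<noteq> 0" "A \<noteq> 0"
      "pochhammer (1 - A) l \<noteq> 0" "pochhammer (1 + of_nat l - A) i \<noteq> 0"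
      using p2 by auto
  qed
  have p3: "of_nat (l choose i) = (- 1) ^ i * pochhammer (- of_nat l) i / (pochhammer 1 i :: 'a)"
    by (simp add: binomial_gbinomial gbinomial_pochhammer pochhammer_fact)
  have p4: "pochhammer (- A) i / (A * (pochhammer (1 - A) l * pochhammer (1 + of_nat l - A) i)) =
      - 1 / pochhammer (of_nat i - A) (Suc l)"
    using p2 nz by (subst frac_eq_eq) simp_all
  have "connection_coeff l N b i = (- 1) ^ i * pochhammer (- of_nat l) i / pochhammer 1 i *
      pochhammer (- N) i * pochhammer (1 - b + of_nat i) (l - i) * (A - 2 * of_nat i) *
      (- 1 / pochhammer (of_nat i - A) (Suc l))"
  proof -
    have "x * (t - A) / D = x * (A - t) * (- 1 / D)" for x t D :: 'a
      by (simp add: left_diff_distrib right_diff_distrib diff_divide_distrib)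
    then show ?thesis
      unfolding connection_coeff_def p3 A_def[symmetric] .
  qed
  also have "\<dots> = pochhammer (1 - b) l / pochhammer (1 - A) l *
    ((- 1) ^ i * ((A - 2 * of_nat i) / A) *
     (pochhammer (- of_nat l) i * pochhammer (- N) i * pochhammer (- A) i /
      (pochhammer 1 i * pochhammer (1 - b) i * pochhammer (1 + of_nat l - A) i)))"
  proof -
    \<comment> \<open>The rearrangement is isolated as a field identity; \<open>p\<close> stands for
      (1 - b)_i, the factor that cancels.\<close>
    have "s * x / f * y * q * t * (z / (A * (w * v))) =
        p * q / w * (s * (t / A) * (x * y * z / (f * p * v)))" if "p \<noteq> 0" for s x f y q t z w v p :: 'a
      using that by (simp add: mult_ac)
    then show ?thesis
      unfolding p4[symmetric] p1 using nzb .
  qed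
  finally show ?thesis by (simp only: A_def)
qed

section \<open>The identity for non-integral 3a\<close>

lemma hypergeometric_3F2_eq_sum:
  "hypergeometric_3F2 (- of_nat n) a1 a2 b1 b2 z =
    (\<Sum>k\<le>n. pochhammer (- of_nat n) k * pochhammer a1 k * pochhammer a2 k
             / (fact k * pochhammer b1 k * pochhammer b2 k) * z ^ k)"
  unfolding hypergeometric_3F2_def
  by (rule suminf_finite) (auto simp: pochhammer_of_nat_eq_0_iff)

text \<open>Duplication formula. The two denominators differ by the factor 4^k, so they vanish
  together and the summands agree in that case too.\<close>

lemma hypergeometric_3F2_eq_cubic_sum:
  "hypergeometric_3F2 (- of_nat n) a (3 * a + of_nat n - of_nat l)
             (3 * a / 2) ((1 + 3 * a) / 2) (3 / 4) = cubic_sum l n a"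
  unfolding hypergeometric_3F2_eq_sum cubic_sum_def
proof (rule sum.cong[OF refl])
  fix k
  have "pochhammer (3 * a) (2 * k) = 4 ^ k * pochhammer (3 * a / 2) k * pochhammer ((1 + 3 * a) / 2) k"
    using pochhammer_double[of "3 * a / 2" k] by (simp add: power_mult add_divide_distrib add.commute)
  then show "pochhammer (- of_nat n) k * pochhammer a k * pochhammer (3 * a + of_nat n - of_nat l) k /
      (fact k * pochhammer (3 * a / 2) k * pochhammer ((1 + 3 * a) / 2) k) * (3 / 4) ^ k =
      pochhammer (- of_nat n) k * pochhammer (3 * a + of_nat n - of_nat l) k *
      (3 ^ k * pochhammer a k / (fact k * pochhammer (3 * a) (2 * k)))"
    by (simp add: power_divide mult_ac)
qed

definition strange_term :: "nat \<Rightarrow> nat \<Rightarrow> complex \<Rightarrow> nat \<Rightarrow> complex" where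
  "strange_term l n a i = (- 1) ^ i *
            ((3 * a + 2 * of_nat n - 2 * of_nat i) / (3 * a + 2 * of_nat n)) *
            (pochhammer (- of_nat l) i * pochhammer (- of_nat n) i *
               pochhammer (- 2 * of_nat n - 3 * a) i /
             (pochhammer 1 i * pochhammer (1 - of_nat n - 3 * a) i *
               pochhammer (1 + of_nat l - 2 * of_nat n - 3 * a) i)) *
            (shifted_factorial (1 / 3) ((int n - int i) div 3) *
               shifted_factorial (2 / 3) ((int n - int i) div 3) /
             (shifted_factorial (1 / 3 + a) ((int n - int i) div 3) *
               shifted_factorial (2 / 3 + a) ((int n - int i) div 3))) *
            chi (int n - int i)"

text \<open>For i > n the factor (-n)_i is zero. Hence every nonzero summand has an index (n - i)/3
  \<ge> 0, where \<open>shifted_factorial\<close> is \<open>pochhammer\<close>.\<close>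

lemma strange_term_eq_0:
  "i > n \<or> \<not> 3 dvd (int n - int i) \<Longrightarrow> strange_term l n a i = 0"
  by (auto simp: strange_term_def chi_def pochhammer_of_nat_eq_0_iff)

lemma cubic_sum_eq_strange_sum_generic:
  fixes a :: complex
  assumes a: "3 * a \<notin> \<int>"
  shows "cubic_sum l n a =
    pochhammer (1 - of_nat n - 3 * a) l / pochhammer (1 - 2 * of_nat n - 3 * a) l *
         (\<Sum>i=0..l. strange_term l n a i)"
  unfolding cubic_sum_expansion[OF a, of l n] sum_distrib_left atMost_atLeast0
proof (rule sum.cong[OF refl])
  fix i assume "i \<in> {0..l}"
  then have i: "i \<le> l" by simp
  define N b where "N = (of_nat n :: complex)" and "b = 3 * a + N"
  have b: "b \<notin> \<int>"
    unfolding b_def N_def using a by (rule nonint_add_of_nat)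
  have Nb: "N + b \<notin> \<int>"
    using nonint_add_of_nat[OF a, of "n + n"] by (simp add: b_def N_def add_ac)
  have e: "1 - N - 3 * a = 1 - b" "1 - 2 * N - 3 * a = 1 - (N + b)" "3 * a + 2 * N = N + b"
    "- 2 * N - 3 * a = - (N + b)" "1 + of_nat l - 2 * N - 3 * a = 1 + of_nat l - (N + b)"
    by (simp_all add: b_def)
  show "connection_coeff l (of_nat n) (3 * a + of_nat n) i * cubic_sum 0 (n - i) a =
    pochhammer (1 - of_nat n - 3 * a) l / pochhammer (1 - 2 * of_nat n - 3 * a) l * strange_term l n a i"
  proof (cases "i > n")
    \<comment> \<open>Here n - i truncates to 0 in \<open>cubic_sum\<close>, but the coefficient
      also contains (-n)_i = 0.\<close>
    case True
    then show ?thesis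
      by (simp add: strange_term_eq_0 connection_coeff_def pochhammer_of_nat_eq_0_iff)
  next
    case False
    then have d: "int n - int i = int (n - i)" by simp
    have s: "shifted_factorial x (int m) = pochhammer x m" for x m
      by (simp add: shifted_factorial_def)
    have c: "cubic_sum 0 (n - i) a =
      shifted_factorial (1 / 3) ((int n - int i) div 3) *
               shifted_factorial (2 / 3) ((int n - int i) div 3) /
             (shifted_factorial (1 / 3 + a) ((int n - int i) div 3) *
               shifted_factorial (2 / 3 + a) ((int n - int i) div 3)) * chi (int n - int i)"
    proof -
      have "int (n - i) div 3 = int ((n - i) div 3)" "3 dvd int (n - i) \<longleftrightarrow> 3 dvd (n - i)"
        by presburger+
      then show ?thesis
        unfolding d cubic_sum_0[OF a] chi_def by (simp only: s) simp
    qed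
    show ?thesis
      unfolding strange_term_def c N_def[symmetric] b_def[symmetric] e
      unfolding connection_coeff_eq[OF b Nb i]
      by (simp only: mult.assoc)
  qed
qed

section \<open>Passage to the remaining a by continuity\<close>

lemma isCont_pochhammer:
  fixes f :: "'a::t2_space \<Rightarrow> 'b::{comm_semiring_1,real_normed_algebra}"
  assumes "isCont f x"
  shows "isCont (\<lambda>x. pochhammer (f x) k) x"
  using assms by (induction k) (auto simp: pochhammer_Suc intro!: continuous_intros)

lemma Im_eq_0_if_Ints: "z \<in> \<int> \<Longrightarrow> Im z = 0"
  by (auto elim!: Ints_cases)

lemma isCont_eqI_nonint:
  fixes f g :: "complex \<Rightarrow> complex"
  assumes f: "isCont f a" and g: "isCont g a" and eq: "\<And>z. 3 * z \<notin> \<int> \<Longrightarrow> f z = g z"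
  shows "f a = g a"
proof (cases "3 * a \<in> \<int>")
  case True
  \<comment> \<open>If 3a is an integer then \<open>a\<close> is real, so approaching it vertically
    keeps the imaginary part nonzero and 3 \<open>s k\<close> non-integral.\<close>
  define s where "s k = a + \<i> * of_real (inverse (real (Suc k)))" for k
  have "s \<longlonglongrightarrow> a + \<i> * of_real 0"
    unfolding s_def by (intro tendsto_intros LIMSEQ_inverse_real_of_nat)
  then have s: "s \<longlonglongrightarrow> a" by simp
  have "f (s k) = g (s k)" for k
  proof (rule eq)
    have "Im (3 * a) = 0" using True by (rule Im_eq_0_if_Ints)
    then have "Im (3 * s k) \<noteq> 0"
      by (simp add: s_def)
    then show "3 * s k \<notin> \<int>" using Im_eq_0_if_Ints by blast
  qed
  then have "(\<lambda>k. f (s k)) = (\<lambda>k. g (s k))" by simp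
  then show ?thesis
    using LIMSEQ_unique isCont_tendsto_compose[OF f s] isCont_tendsto_compose[OF g s] by metis
qed (rule eq)

theorem theorem2:
  fixes l n :: nat and a :: complex
  assumes "\<And>k. k \<le> n \<Longrightarrow> pochhammer (3 * a / 2) k \<noteq> 0"
    and "\<And>k. k \<le> n \<Longrightarrow> pochhammer ((1 + 3 * a) / 2) k \<noteq> 0"
    and "pochhammer (1 - 2 * of_nat n - 3 * a) l \<noteq> 0"
    and "\<And>i. i \<le> l \<Longrightarrow> 3 dvd (int n - int i) \<Longrightarrow> 3 * a + 2 * of_nat n \<noteq> 0"
    and "\<And>i. i \<le> l \<Longrightarrow> 3 dvd (int n - int i) \<Longrightarrow>
           pochhammer (1 - of_nat n - 3 * a) i \<noteq> 0"
    and "\<And>i. i \<le> l \<Longrightarrow> 3 dvd (int n - int i) \<Longrightarrow>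
           pochhammer (1 + of_nat l - 2 * of_nat n - 3 * a) i \<noteq> 0"
    and "\<And>i. i \<le> l \<Longrightarrow> 3 dvd (int n - int i) \<Longrightarrow>
           shifted_factorial (1 / 3 + a) ((int n - int i) div 3) \<noteq> 0"
    and "\<And>i. i \<le> l \<Longrightarrow> 3 dvd (int n - int i) \<Longrightarrow>
           shifted_factorial (2 / 3 + a) ((int n - int i) div 3) \<noteq> 0"
  shows "hypergeometric_3F2 (- of_nat n) a (3 * a + of_nat n - of_nat l)
             (3 * a / 2) ((1 + 3 * a) / 2) (3 / 4) =
         pochhammer (1 - of_nat n - 3 * a) l / pochhammer (1 - 2 * of_nat n - 3 * a) l *
         (\<Sum>i=0..l. (- 1) ^ i *
            ((3 * a + 2 * of_nat n - 2 * of_nat i) / (3 * a + 2 * of_nat n)) *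
            (pochhammer (- of_nat l) i * pochhammer (- of_nat n) i *
               pochhammer (- 2 * of_nat n - 3 * a) i /
             (pochhammer 1 i * pochhammer (1 - of_nat n - 3 * a) i *
               pochhammer (1 + of_nat l - 2 * of_nat n - 3 * a) i)) *
            (shifted_factorial (1 / 3) ((int n - int i) div 3) *
               shifted_factorial (2 / 3) ((int n - int i) div 3) /
             (shifted_factorial (1 / 3 + a) ((int n - int i) div 3) *
               shifted_factorial (2 / 3 + a) ((int n - int i) div 3))) *
            chi (int n - int i))"
proof -
  \<comment> \<open>Noncontributing summands are identically zero in \<open>z\<close>, hence
    continuous even where their denominators vanish; for the others the hypotheses exclude zero
    denominators at \<open>a\<close>.\<close>
  have terms: "isCont (\<lambda>z. strange_term l n z i) a" if i: "i \<le> l" for i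
  proof (cases "i > n \<or> \<not> 3 dvd (int n - int i)")
    case True
    then show ?thesis by (simp add: strange_term_eq_0)
  next
    case False
    then have d: "3 dvd (int n - int i)" and nonneg: "(int n - int i) div 3 \<ge> 0" by auto
    have s: "shifted_factorial x ((int n - int i) div 3) = pochhammer x (nat ((int n - int i) div 3))" for x
      using nonneg by (simp add: shifted_factorial_def)
    have "pochhammer 1 i \<noteq> (0 :: complex)"
      by (simp flip: pochhammer_fact)
    with assms(4-8)[OF i d] show ?thesis
      unfolding strange_term_def s
      by (intro continuous_intros isCont_pochhammer) simp_all
  qed
  have "cubic_sum l n a = pochhammer (1 - of_nat n - 3 * a) l / pochhammer (1 - 2 * of_nat n - 3 * a) l *
         (\<Sum>i=0..l. strange_term l n a i)"
  proof (rule isCont_eqI_nonint[OF _ _ cubic_sum_eq_strange_sum_generic])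
    \<comment> \<open>Continuity is shown in the hypergeometric form because the hypotheses concern
      its lower parameters 3a/2 and (1 + 3a)/2.\<close>
    have "isCont (\<lambda>z. hypergeometric_3F2 (- of_nat n) z (3 * z + of_nat n - of_nat l)
             (3 * z / 2) ((1 + 3 * z) / 2) (3 / 4)) a"
      unfolding hypergeometric_3F2_eq_sum using assms(1,2)
      by (intro continuous_intros isCont_pochhammer) simp_all
    then show "isCont (\<lambda>z. cubic_sum l n z) a"
      by (simp only: hypergeometric_3F2_eq_cubic_sum)
    show "isCont (\<lambda>z. pochhammer (1 - of_nat n - 3 * z) l / pochhammer (1 - 2 * of_nat n - 3 * z) l *
         (\<Sum>i=0..l. strange_term l n z i)) a"
      using assms(3) terms by (intro continuous_intros isCont_pochhammer) simp_all
  qed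
  then show ?thesis
    unfolding hypergeometric_3F2_eq_cubic_sum strange_term_def .
qed

end
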